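(* Let $a,b$ be integers with $1<a<b$ and let $b$ be even. Then the equation $(a^{n}-1)(b^{2n}a^{n}-1)=x^{2}$ has no solutions in positive integers $n,x$. *)

theory Defs
  imports Main
begin

end

theory Submission
  imports Defs
begin

text \<open>
  With \<open>A = a ^ n\<close> and \<open>B = b ^ n\<close> the equation reads
  \<open>(A - 1) * (A * B\<^sup>2 - 1) = x\<^sup>2\<close>. Writing \<open>A - 1 = D * y\<^sup>2\<close> with \<open>D\<close> squarefree, a solution makes
  \<open>(B, Y)\<close>, for some \<open>Y\<close>, a solution of the Pell-type equation \<open>A * X\<^sup>2 - D * Y\<^sup>2 = 1\<close>, whose
  smallest solution is \<open>(1, y)\<close>. All its positive solutions come from odd powers of
  \<open>\<surd>A + y * \<surd>D\<close>, and passing from one to the next changes \<open>X\<close> by an even number, so every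
  \<open>X\<close> is odd like the first one. Hence \<open>B\<close> is odd, which is impossible for even \<open>b\<close>.

  The proof below carries this out as an infinite descent. Multiplication by
  \<open>(\<surd>A - y * \<surd>D)\<^sup>2\<close>, expressed through \<open>x = D * y * Y\<close>, becomes the map
  \<open>(X, x) \<mapsto> ((2 * A - 1) * X - 2 * x, (2 * A - 1) * x - 2 * A * (A - 1) * X)\<close>,
  in which \<open>D\<close> and \<open>y\<close> no longer occur. It preserves the equation
  \<open>(A - 1) * (A * X\<^sup>2 - 1) = x\<^sup>2\<close> and the parity of \<open>X\<close>, and it makes every \<open>X > 1\<close>
  smaller while keeping it positive (\<open>descent_solution\<close>, \<open>descent_bounds\<close>,
  \<open>root_coordinate_odd\<close>).
\<close>

text \<open>
  The map is multiplication by a unit of norm \<open>(2 * A - 1)\<^sup>2 - 4 * A * (A - 1) = 1\<close>; this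
  identity is what collapses the expanded squares.
\<close>

lemma descent_solution:
  fixes A X x :: "'a::comm_ring_1"
  assumes "(A - 1) * (A * X\<^sup>2 - 1) = x\<^sup>2"
  shows "(A - 1) * (A * ((2 * A - 1) * X - 2 * x)\<^sup>2 - 1)
           = ((2 * A - 1) * x - 2 * A * (A - 1) * X)\<^sup>2"
proof -
  have "(A - 1) * (A * ((2 * A - 1) * X - 2 * x)\<^sup>2 - 1)
          - ((2 * A - 1) * x - 2 * A * (A - 1) * X)\<^sup>2
        = (A - 1) * (A * X\<^sup>2 - 1) - x\<^sup>2"
    by (simp add: power2_eq_square algebra_simps)
  with assms show ?thesis
    by simp
qed

text \<open>
  The equation places \<open>x\<close> just below \<open>(A - 1/2) * X\<close> and, once \<open>X > 1\<close>, above
  \<open>(A - 1) * X\<close>; both comparisons are made between squares.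
\<close>

lemma descent_bounds:
  fixes A X x :: "'a::linordered_idom"
  assumes "1 < A" and "1 < X" and "0 \<le> x"
    and eq: "(A - 1) * (A * X\<^sup>2 - 1) = x\<^sup>2"
  shows "0 < (2 * A - 1) * X - 2 * x" and "(2 * A - 1) * X - 2 * x < X"
proof -
  have "((2 * A - 1) * X)\<^sup>2 - (2 * x)\<^sup>2 = X\<^sup>2 + 4 * (A - 1)"
    using eq by algebra
  moreover have "0 < X\<^sup>2 + 4 * (A - 1)"
    using \<open>1 < A\<close> by (intro add_nonneg_pos) simp_all
  ultimately have "(2 * x)\<^sup>2 < ((2 * A - 1) * X)\<^sup>2"
    by simp
  moreover have "0 \<le> (2 * A - 1) * X"
    using \<open>1 < A\<close> \<open>1 < X\<close> by (intro mult_nonneg_nonneg) simp_all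
  ultimately have "2 * x < (2 * A - 1) * X"
    by (rule power2_less_imp_less)
  then show "0 < (2 * A - 1) * X - 2 * x"
    by simp
  have "x\<^sup>2 - ((A - 1) * X)\<^sup>2 = (A - 1) * (X\<^sup>2 - 1)"
    using eq by algebra
  moreover have "0 < (A - 1) * (X\<^sup>2 - 1)"
    using \<open>1 < A\<close> \<open>1 < X\<close> by (simp add: one_less_power)
  ultimately have "((A - 1) * X)\<^sup>2 < x\<^sup>2"
    by simp
  then have "(A - 1) * X < x"
    using \<open>0 \<le> x\<close> by (rule power2_less_imp_less)
  then show "(2 * A - 1) * X - 2 * x < X"
    by (simp add: algebra_simps)
qed

text \<open>
  An even positive \<open>X\<close> exceeds \<open>1\<close>, so the descent always applies to it and produces a
  smaller even positive value, without end.
\<close>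

lemma root_coordinate_odd:
  fixes A X x :: int
  assumes "1 < A" and "0 < X" and "(A - 1) * (A * X\<^sup>2 - 1) = x\<^sup>2"
  shows "odd X"
  using assms(2,3)
proof (induction "nat X" arbitrary: X x rule: less_induct)
  case less
  show ?case
  proof
    assume "even X"
    with \<open>0 < X\<close> have "1 < X"
      by (cases "X = 1") auto
    \<comment> \<open>The sign of \<open>x\<close> decides whether the map moves down or up the chain of solutions;
      the absolute value selects the downward direction.\<close>
    have eq: "(A - 1) * (A * X\<^sup>2 - 1) = \<bar>x\<bar>\<^sup>2"
      using less.prems by simp
    define X' where "X' = (2 * A - 1) * X - 2 * \<bar>x\<bar>"
    have "0 < X'" and "X' < X"
      unfolding X'_def using descent_bounds[OF \<open>1 < A\<close> \<open>1 < X\<close> _ eq] by simp_all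
    moreover from this have "nat X' < nat X"
      by simp
    ultimately have "odd X'"
      using less.hyps descent_solution[OF eq] unfolding X'_def by blast
    with \<open>even X\<close> show False
      by (simp add: X'_def)
  qed
qed

theorem theorem22:
  fixes a b :: int
  assumes "1 < a" and "a < b" and "even b"
  shows "\<not> (\<exists>(n::nat) (x::int). 0 < n \<and> 0 < x \<and> (a ^ n - 1) * (b ^ (2 * n) * a ^ n - 1) = x ^ 2)"
proof
  assume "\<exists>(n::nat) (x::int). 0 < n \<and> 0 < x \<and> (a ^ n - 1) * (b ^ (2 * n) * a ^ n - 1) = x ^ 2"
  then obtain n :: nat and x :: int
    where "0 < n" and eq: "(a ^ n - 1) * (b ^ (2 * n) * a ^ n - 1) = x\<^sup>2"
    by blast
  have "(a ^ n - 1) * (a ^ n * (b ^ n)\<^sup>2 - 1) = x\<^sup>2"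
    using eq by (simp add: power_even_eq mult.commute[of _ "a ^ n"])
  moreover have "1 < a ^ n"
    using \<open>1 < a\<close> \<open>0 < n\<close> by (simp add: one_less_power)
  moreover have "0 < b ^ n"
    using \<open>1 < a\<close> \<open>a < b\<close> by simp
  ultimately have "odd (b ^ n)"
    using root_coordinate_odd by blast
  with \<open>even b\<close> \<open>0 < n\<close> show False
    by simp
qed

end
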